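(* Assume that the known functions $f,c^0$ on $[0,L]$ and $I,\varepsilon_A,\varepsilon_B$ on $[\lambda_0,\lambda_*]$ are continuously differentiable, with $f\ge 0$, $0\le I\le 1$, $c^0>0$, and let $\phi:(0,\infty)\to(0,\infty)$ satisfy $\phi(\Delta t)=\Delta t+\mathcal{O}(\Delta t^2)$ as $\Delta t\to 0$. Then the NSFD method is consistent with the integro-differential photochemical model (both described in the context), of order $1$; that is, there is a constant $\kappa>0$, independent of the stepsizes, such that for $\Delta x=L/N_x$, $\Delta t=T/N_t$, $\Delta\lambda=(\lambda_*-\lambda_0)/N_\lambda$ with $N_x,N_t,N_\lambda$ positive integers, the local truncation error $\delta_j^n$ satisfies $$\max_{0\le n\le N_t-1,\;0\le j\le N_x}|\delta_j^n|\le\kappa(\Delta t+\Delta x+\Delta\lambda).$$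
   Context: Constants: $L,T>0$, $\lambda_0<\lambda_*$, $\mu>0$, $a_1>0$, $a_2\ge 0$. Put $\rho(X)=\dfrac{a_1X}{X^2+a_2X+1}$ for $X\ge 0$, $C_0(x)=\int_0^x c^0(\xi)\,d\xi$, and $$\iota(\lambda,y,s)=I(\lambda)\exp\{-\mu(\varepsilon_B(\lambda)\,y+(\varepsilon_A(\lambda)-\varepsilon_B(\lambda))\,s)\}.$$ Model: $c(x,t)$ is the (classical) solution on $[0,L]\times[0,T]$ of $$\frac{\partial c}{\partial t}(x,t)=-c(x,t)f(x)\int_{\lambda_0}^{\lambda_*}\rho\Big(\iota\Big(\lambda,C_0(x),\int_0^x c(\xi,t)\,d\xi\Big)\Big)d\lambda,\qquad c(x,0)=c^0(x).$$ Grid: $x_j=j\Delta x$, $t_n=n\Delta t$, $\lambda_l=\lambda_0+l\Delta\lambda$. NSFD scheme: $c_j^0=c^0(x_j)$ and $$\frac{c_j^{n+1}-c_j^n}{\phi(\Delta t)}=-c_j^{n+1}f(x_j)\,\Delta\lambda\sum_{l=0}^{N_\lambda-1}\rho\Big(\iota\Big(\lambda_l,C_0(x_j),\Delta x\sum_{r=0}^{j-1}c_r^n\Big)\Big).$$ Local truncation error: $$\begin{aligned}\delta_j^n=&\ \frac{\partial c}{\partial t}(x_j,t_n)+c(x_j,t_n)f(x_j)\int_{\lambda_0}^{\lambda_*}\rho\Big(\iota\Big(\lambda,C_0(x_j),\int_0^{x_j}c(\xi,t_n)\,d\xi\Big)\Big)d\lambda\\&-\frac{c(x_j,t_n+\Delta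 t)-c(x_j,t_n)}{\phi(\Delta t)}-c(x_j,t_n+\Delta t)f(x_j)\,\Delta\lambda\sum_{l=0}^{N_\lambda-1}\rho\Big(\iota\Big(\lambda_l,C_0(x_j),\Delta x\sum_{r=0}^{j-1}c(x_r,t_n)\Big)\Big).\end{aligned}$$ *)

theory Defs
  imports "HOL-Analysis.Analysis" "HOL-Library.Landau_Symbols"
begin

text \<open>
  Functions given on a compact interval are total functions of which only the restriction matters:
  derivatives at the end points are one-sided (unlike in the library's \<open>C1_differentiable_on\<close>).
\<close>
definition C1_on :: "(real \<Rightarrow> real) \<Rightarrow> real \<Rightarrow> real \<Rightarrow> bool" where
  "C1_on g a b \<longleftrightarrow>
     (\<exists>g'. (\<forall>x\<in>{a..b}. (g has_real_derivative g' x) (at x within {a..b})) \<and> continuous_on {a..b} g')"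

definition rho :: "real \<Rightarrow> real \<Rightarrow> real \<Rightarrow> real" where
  "rho a1 a2 X = a1 * X / (X\<^sup>2 + a2 * X + 1)"

definition iota ::
  "real \<Rightarrow> (real \<Rightarrow> real) \<Rightarrow> (real \<Rightarrow> real) \<Rightarrow> (real \<Rightarrow> real) \<Rightarrow> real \<Rightarrow> real \<Rightarrow> real \<Rightarrow> real" where
  "iota \<mu> I \<epsilon>A \<epsilon>B l y s = I l * exp (- \<mu> * (\<epsilon>B l * y + (\<epsilon>A l - \<epsilon>B l) * s))"

definition photo_kernel :: "real \<Rightarrow> real \<Rightarrow> real \<Rightarrow> (real \<Rightarrow> real) \<Rightarrow> (real \<Rightarrow> real) \<Rightarrow> (real \<Rightarrow> real)
    \<Rightarrow> real \<Rightarrow> real \<Rightarrow> real \<Rightarrow> real" where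
  "photo_kernel a1 a2 \<mu> I \<epsilon>A \<epsilon>B l y s = rho a1 a2 (iota \<mu> I \<epsilon>A \<epsilon>B l y s)"

definition C0 :: "(real \<Rightarrow> real) \<Rightarrow> real \<Rightarrow> real" where
  "C0 c0 x = integral {0..x} c0"

text \<open>In the following, \<open>K\<close> stands for a kernel \<open>(\<lambda>, y, s) \<mapsto> \<rho>(\<iota>(\<lambda>, y, s))\<close>.\<close>

definition rate :: "(real \<Rightarrow> real \<Rightarrow> real \<Rightarrow> real) \<Rightarrow> real \<Rightarrow> real \<Rightarrow> (real \<Rightarrow> real)
    \<Rightarrow> (real \<Rightarrow> real \<Rightarrow> real) \<Rightarrow> real \<Rightarrow> real \<Rightarrow> real" where
  "rate K lam0 lam1 c0 c x t =
     integral {lam0..lam1} (\<lambda>l. K l (C0 c0 x) (integral {0..x} (\<lambda>\<xi>. c \<xi> t)))"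

text \<open>
  Only continuity of \<open>c\<close> and existence of its time derivative are required; continuity of the
  time derivative then follows from the equation when the data are continuous.
\<close>
definition classical_solution :: "(real \<Rightarrow> real \<Rightarrow> real \<Rightarrow> real) \<Rightarrow> real \<Rightarrow> real \<Rightarrow> (real \<Rightarrow> real)
    \<Rightarrow> (real \<Rightarrow> real) \<Rightarrow> real \<Rightarrow> real \<Rightarrow> (real \<Rightarrow> real \<Rightarrow> real) \<Rightarrow> bool" where
  "classical_solution K lam0 lam1 f c0 L T c \<longleftrightarrow>
     continuous_on ({0..L} \<times> {0..T}) (\<lambda>(x, t). c x t) \<and>
     (\<forall>x\<in>{0..L}. \<forall>t\<in>{0..T}.
        ((\<lambda>s. c x s) has_real_derivative - c x t * f x * rate K lam0 lam1 c0 c x t)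
          (at t within {0..T})) \<and>
     (\<forall>x\<in>{0..L}. c x 0 = c0 x)"

definition time_deriv :: "real \<Rightarrow> (real \<Rightarrow> real \<Rightarrow> real) \<Rightarrow> real \<Rightarrow> real \<Rightarrow> real" where
  "time_deriv T c x t = vector_derivative (\<lambda>s. c x s) (at t within {0..T})"

definition model_residual :: "(real \<Rightarrow> real \<Rightarrow> real \<Rightarrow> real) \<Rightarrow> real \<Rightarrow> real \<Rightarrow> (real \<Rightarrow> real)
    \<Rightarrow> (real \<Rightarrow> real) \<Rightarrow> real \<Rightarrow> (real \<Rightarrow> real \<Rightarrow> real) \<Rightarrow> real \<Rightarrow> real \<Rightarrow> real" where
  "model_residual K lam0 lam1 f c0 T c x t =
     time_deriv T c x t + c x t * f x * rate K lam0 lam1 c0 c x t"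

text \<open>
  The NSFD scheme for a grid function \<open>u j n\<close> (space index first) is \<open>u j 0 = c0 (j * dx)\<close> together
  with \<open>nsfd_residual \<dots> u j n = 0\<close>.
\<close>
definition nsfd_residual :: "(real \<Rightarrow> real \<Rightarrow> real \<Rightarrow> real) \<Rightarrow> real \<Rightarrow> (real \<Rightarrow> real) \<Rightarrow> (real \<Rightarrow> real)
    \<Rightarrow> (real \<Rightarrow> real) \<Rightarrow> real \<Rightarrow> real \<Rightarrow> real \<Rightarrow> nat \<Rightarrow> (nat \<Rightarrow> nat \<Rightarrow> real) \<Rightarrow> nat \<Rightarrow> nat \<Rightarrow> real" where
  "nsfd_residual K lam0 f c0 \<phi> dt dx dlam Nlam u j n =
     (u j (n + 1) - u j n) / \<phi> dt
     + u j (n + 1) * f (real j * dx) *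
       (dlam * (\<Sum>l<Nlam. K (lam0 + real l * dlam) (C0 c0 (real j * dx)) (dx * (\<Sum>r<j. u r n))))"

definition truncation_error :: "(real \<Rightarrow> real \<Rightarrow> real \<Rightarrow> real) \<Rightarrow> real \<Rightarrow> real \<Rightarrow> (real \<Rightarrow> real)
    \<Rightarrow> (real \<Rightarrow> real) \<Rightarrow> real \<Rightarrow> (real \<Rightarrow> real) \<Rightarrow> (real \<Rightarrow> real \<Rightarrow> real)
    \<Rightarrow> real \<Rightarrow> real \<Rightarrow> real \<Rightarrow> nat \<Rightarrow> nat \<Rightarrow> nat \<Rightarrow> real" where
  "truncation_error K lam0 lam1 f c0 T \<phi> c dt dx dlam Nlam j n =
     model_residual K lam0 lam1 f c0 T c (real j * dx) (real n * dt)
     - nsfd_residual K lam0 f c0 \<phi> dt dx dlam Nlam (\<lambda>j n. c (real j * dx) (real n * dt)) j n"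

end

theory Submission
  imports Defs
begin

text \<open>
  The error measures how far the exact solution \<open>c\<close> is from satisfying the scheme. Since \<open>c\<close> satisfies
  the differential equation, the contribution of the model vanishes, and with
  \<open>c_t = - c f R\<close> (where \<open>R\<close> is the integral of the kernel \<open>K\<close> over the wavelengths, and \<open>Q\<close> its discrete
  counterpart) the error is, up to sign, the sum of
  \<open>(c(x, t + h) - c(x, t)) / \<phi>(h) - c_t(x, t)\<close> and \<open>c(x, t + h) f(x) Q - c(x, t) f(x) R(x, t)\<close>.
  Both are of first order once three Lipschitz properties of \<open>c\<close> are available, with constants that hold
  on the whole rectangle.

  In time (\<open>c_lipschitz_time\<close>, \<open>c_t_lipschitz_time\<close>), the equation bootstraps: \<open>c\<close> and \<open>K\<close> are bounded,
  so \<open>c_t\<close> is bounded and \<open>c\<close> is Lipschitz; hence so are its space integral, \<open>R\<close>, and finally \<open>c_t\<close>.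
  The forward difference with step \<open>h\<close> in the denominator is therefore first order accurate, and
  replacing \<open>h\<close> by \<open>\<phi>(h)\<close> costs a relative error of order \<open>h\<close> (\<open>denominator_function_bound\<close>).

  In space (\<open>c_lipschitz_space\<close>), \<open>R\<close> is Lipschitz, because \<open>x\<close> enters only as the upper limit of
  integrals of bounded functions. The difference of \<open>c\<close> at two points then
  solves a linear equation in time whose initial value and right-hand side are both bounded by a multiple
  of the distance of the points and whose coefficient is damping; a Gronwall argument transports this
  bound to all times.

  Given these properties, \<open>Q\<close> arises from \<open>R\<close> by two applications of the left rectangle rule, to a
  function that is Lipschitz in the wavelength and to one that is Lipschitz in \<open>x\<close>; that rule has first
  order error (\<open>left_rectangle_rule_error\<close>, \<open>quadrature_error\<close>).

  The kernel enters through its boundedness, its nonnegativity and its Lipschitz property on a compact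
  box, so the analysis is done for an abstract kernel with these properties, and the photochemical one
  is shown to be an instance (\<open>photo_kernel_lipschitz\<close>).
\<close>

section \<open>Lipschitz functions\<close>

lemma C1_on_imp_lipschitz:
  assumes "C1_on g a b"
  shows "\<exists>C. C-lipschitz_on {a..b} g"
proof -
  obtain g' where g': "\<And>x. x \<in> {a..b} \<Longrightarrow> (g has_real_derivative g' x) (at x within {a..b})"
    and cont: "continuous_on {a..b} g'"
    using assms unfolding C1_on_def by blast
  have "bounded (g' ` {a..b})"
    by (intro compact_imp_bounded compact_continuous_image cont compact_Icc)
  then obtain C where "C > 0" and C: "\<And>x. x \<in> {a..b} \<Longrightarrow> norm (g' x) \<le> C"
    unfolding bounded_pos by auto
  have "C-lipschitz_on {a..b} g"
  proof (rule lipschitz_onI)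
    fix x y assume "x \<in> {a..b}" "y \<in> {a..b}"
    then show "dist (g x) (g y) \<le> C * dist x y"
      unfolding dist_norm
      by (intro field_differentiable_bound[where f' = g' and S = "{a..b}"] g' C) auto
  qed (use \<open>C > 0\<close> in simp)
  then show ?thesis ..
qed

lemma lipschitz_mult_compact:
  fixes g h :: "'a::metric_space \<Rightarrow> real"
  assumes "compact U" "C-lipschitz_on U g" "D-lipschitz_on U h"
  shows "\<exists>E. E-lipschitz_on U (\<lambda>x. g x * h x)"
proof -
  have "bounded (g ` U)" "bounded (h ` U)"
    using assms by (auto intro!: compact_imp_bounded compact_continuous_image
        lipschitz_on_continuous_on)
  then obtain G H where G: "\<And>x. x \<in> U \<Longrightarrow> \<bar>g x\<bar> \<le> G" "G > 0"
    and H: "\<And>x. x \<in> U \<Longrightarrow> \<bar>h x\<bar> \<le> H" "H > 0"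
    unfolding bounded_pos by auto
  have "C \<ge> 0" "D \<ge> 0"
    using assms lipschitz_on_nonneg by auto
  have "(G * D + H * C)-lipschitz_on U (\<lambda>x. g x * h x)"
  proof (rule lipschitz_onI)
    fix x y assume xy: "x \<in> U" "y \<in> U"
    have "\<bar>g x * h x - g y * h y\<bar> = \<bar>g x * (h x - h y) + h y * (g x - g y)\<bar>"
      by (simp add: algebra_simps)
    also have "\<dots> \<le> \<bar>g x\<bar> * \<bar>h x - h y\<bar> + \<bar>h y\<bar> * \<bar>g x - g y\<bar>"
      by (metis abs_mult abs_triangle_ineq)
    also have "\<dots> \<le> G * (D * dist x y) + H * (C * dist x y)"
      using xy G H assms(2,3)[THEN lipschitz_onD, OF xy]
      by (intro add_mono mult_mono) (auto simp: dist_real_def)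
    finally show "dist (g x * h x) (g y * h y) \<le> (G * D + H * C) * dist x y"
      by (simp add: dist_real_def algebra_simps)
  qed (use G H \<open>C \<ge> 0\<close> \<open>D \<ge> 0\<close> in simp)
  then show ?thesis ..
qed

lemma lipschitz_exp_compact:
  fixes g :: "'a::metric_space \<Rightarrow> real"
  assumes "compact U" "C-lipschitz_on U g"
  shows "\<exists>D. D-lipschitz_on U (\<lambda>x. exp (g x))"
proof -
  have "bounded (g ` U)"
    using assms by (auto intro!: compact_imp_bounded compact_continuous_image
        lipschitz_on_continuous_on)
  then obtain G where "\<And>x. x \<in> U \<Longrightarrow> \<bar>g x\<bar> \<le> G"
    unfolding bounded_pos by auto
  then have G: "g ` U \<subseteq> {-G..G}"
    by (fastforce simp: abs_le_iff)
  have "C1_on exp (-G) G"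
    unfolding C1_on_def
    by (intro exI[of _ exp] conjI ballI DERIV_subset[OF DERIV_exp] continuous_intros) auto
  then obtain E where "E-lipschitz_on {-G..G} (exp :: real \<Rightarrow> real)"
    using C1_on_imp_lipschitz by blast
  then have "E-lipschitz_on (g ` U) (exp :: real \<Rightarrow> real)"
    using G lipschitz_on_subset by blast
  from lipschitz_on_compose2[OF assms(2) this] show ?thesis by blast
qed

text \<open>
  The derivative of the integral with respect to its upper limit is the integrand, so a bound of the
  integrand is a Lipschitz constant. This is the only way in which the space variable enters the kernel.
\<close>
lemma lipschitz_integral_upper:
  fixes g :: "real \<Rightarrow> real"
  assumes "continuous_on {a..b} g" "\<And>x. x \<in> {a..b} \<Longrightarrow> \<bar>g x\<bar> \<le> M" "M \<ge> 0"
  shows "M-lipschitz_on {a..b} (\<lambda>x. integral {a..x} g)"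
proof (rule lipschitz_onI)
  fix x y assume "x \<in> {a..b}" "y \<in> {a..b}"
  then show "dist (integral {a..x} g) (integral {a..y} g) \<le> M * dist x y"
    unfolding dist_norm
    by (intro field_differentiable_bound[where f' = g and S = "{a..b}"]
        integral_has_real_derivative) (use assms in auto)
qed (use assms in auto)

text \<open>
  Derivatives at the end points of the time interval are one-sided, so the mean value theorem is needed for
  derivatives within a set \<open>S\<close> that may be larger than \<open>{a..b}\<close>.
\<close>
lemma mean_value_within:
  fixes g :: "real \<Rightarrow> real"
  assumes "a \<le> b" "{a..b} \<subseteq> S"
    and deriv: "\<And>s. s \<in> S \<Longrightarrow> (g has_real_derivative g' s) (at s within S)"
  shows "\<exists>\<tau>\<in>{a..b}. g b - g a = g' \<tau> * (b - a)"
proof (rule mvt_very_simple)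
  fix s assume "a \<le> s" "s \<le> b"
  then have "(g has_real_derivative g' s) (at s within {a..b})"
    using assms by (intro DERIV_subset[OF deriv]) auto
  then show "(g has_derivative (*) (g' s)) (at s within {a..b})"
    by (simp add: has_field_derivative_def)
qed fact

section \<open>The left rectangle rule and the denominator function\<close>

text \<open>
  On a cell of length \<open>h\<close> the integrand differs by at most \<open>B * h\<close> from its value at the left end, so each
  cell contributes an error of at most \<open>B * h * h\<close>. The number of cells may be \<open>0\<close>: this occurs at the left end
  of the space interval, where both the integral and the sum are empty.
\<close>
lemma left_rectangle_rule_error:
  fixes g :: "real \<Rightarrow> real"
  assumes "h \<ge> 0" "B-lipschitz_on {a..a + real N * h} g"
  shows "\<bar>h * (\<Sum>i<N. g (a + real i * h)) - integral {a..a + real N * h} g\<bar> \<le> B * (real N * h) * h"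
  using assms(2)
proof (induction N)
  case 0
  then show ?case by simp
next
  case (Suc N)
  define p q where "p = a + real N * h" and "q = a + real (Suc N) * h"
  have q: "q = p + h" "a \<le> p" "p \<le> q"
    using \<open>h \<ge> 0\<close> by (auto simp: p_def q_def algebra_simps)
  have lip: "B-lipschitz_on {a..q} g"
    using Suc.prems by (simp add: q_def)
  then have "B \<ge> 0"
    by (rule lipschitz_on_nonneg)
  have cont: "continuous_on {a..q} g"
    using lip by (rule lipschitz_on_continuous_on)
  have IH: "\<bar>h * (\<Sum>i<N. g (a + real i * h)) - integral {a..p} g\<bar> \<le> B * (real N * h) * h"
    unfolding p_def by (rule Suc.IH, rule lipschitz_on_subset[OF lip]) (use q p_def in auto)
  have int: "g integrable_on {a..q}"
    using cont by (rule integrable_continuous_real)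
  have split: "integral {a..q} g = integral {a..p} g + integral {p..q} g"
    using Henstock_Kurzweil_Integration.integral_combine[OF q(2,3) int] by simp
  have contp: "continuous_on {p..q} g"
    using cont q by (auto elim: continuous_on_subset)
  have "integral {p..q} (\<lambda>x. g p - g x) = h * g p - integral {p..q} g"
    using q contp by (subst integral_diff) (auto intro: integrable_continuous_real)
  moreover have "norm (integral {p..q} (\<lambda>x. g p - g x)) \<le> B * h * (q - p)"
  proof (rule integral_bound)
    fix x assume x: "x \<in> {p..q}"
    have "\<bar>g p - g x\<bar> \<le> B * \<bar>p - x\<bar>"
      using lipschitz_onD[OF lip, of p x] x q by (auto simp: dist_real_def)
    also have "\<dots> \<le> B * h"
      using x q \<open>B \<ge> 0\<close> by (intro mult_left_mono) auto
    finally show "norm (g p - g x) \<le> B * h" by simp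
  qed (use q contp in \<open>auto intro!: continuous_intros\<close>)
  ultimately have "\<bar>h * g p - integral {p..q} g\<bar> \<le> B * h * h"
    using q by simp
  then have "\<bar>(h * (\<Sum>i<N. g (a + real i * h)) - integral {a..p} g) + (h * g p - integral {p..q} g)\<bar>
    \<le> B * (real N * h) * h + B * h * h"
    using IH by linarith
  moreover have "h * (\<Sum>i<Suc N. g (a + real i * h)) = h * (\<Sum>i<N. g (a + real i * h)) + h * g p"
    unfolding p_def by (simp add: distrib_left)
  ultimately show ?case
    unfolding q_def[symmetric] split by (simp only: of_nat_Suc) (simp add: algebra_simps del: sum.lessThan_Suc)
qed

text \<open>
  Close to \<open>0\<close> the hypothesis gives \<open>\<bar>\<phi> h - h\<bar> \<le> C * h\<^sup>2\<close>, and as soon as \<open>h < 1 / (2 * C)\<close> also \<open>\<phi> h \<ge> h / 2\<close>,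
  whence the relative error is at most \<open>2 * C * h\<close>. Away from \<open>0\<close> the function \<open>\<phi>\<close> may be arbitrarily small,
  so a bound for all step sizes in \<open>{0<..T}\<close> may fail; but only finitely many of the step sizes \<open>T / N\<close> are
  not close to \<open>0\<close>. In other words, a sequence that is eventually bounded is bounded.
\<close>
lemma denominator_function_bound:
  fixes \<phi> :: "real \<Rightarrow> real"
  assumes "T > 0" and pos: "\<forall>h>0. \<phi> h > 0"
    and bigo: "(\<lambda>h. \<phi> h - h) \<in> O[at_right 0](\<lambda>h. h\<^sup>2)"
  shows "\<exists>\<Gamma>\<ge>0. \<forall>N>0. \<bar>(T / real N) / \<phi> (T / real N) - 1\<bar> \<le> \<Gamma> * (T / real N)"
proof -
  from bigo obtain C where "C > 0"
    and C: "\<forall>\<^sub>F h in at_right 0. norm (\<phi> h - h) \<le> C * norm (h\<^sup>2)"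
    by (rule landau_o.bigE)
  have "\<forall>\<^sub>F h in at_right 0. h < 1 / (2 * C)" "\<forall>\<^sub>F h in at_right 0. (h::real) > 0"
    using \<open>C > 0\<close> by (auto intro: order_tendstoD eventually_at_right_less)
  with C have ev: "\<forall>\<^sub>F h in at_right 0. norm ((h / \<phi> h - 1) / h) \<le> 2 * C"
  proof eventually_elim
    case (elim h)
    have "C * h * h \<le> 1 / 2 * h"
      using elim \<open>C > 0\<close> by (intro mult_right_mono) (auto simp: field_simps)
    moreover have "h - \<phi> h \<le> C * h * h"
      using elim by (simp add: power2_eq_square abs_le_iff mult.assoc)
    ultimately have "\<phi> h \<ge> h / 2"
      by linarith
    have "\<phi> h > 0"
      using elim pos by simp
    have "\<bar>h / \<phi> h - 1\<bar> = \<bar>\<phi> h - h\<bar> / \<phi> h"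
      using \<open>\<phi> h > 0\<close> by (simp add: field_simps abs_minus_commute)
    also have "\<dots> \<le> (C * h\<^sup>2) / (h / 2)"
      using elim \<open>\<phi> h \<ge> h / 2\<close> \<open>C > 0\<close> by (intro frac_le) auto
    finally show ?case
      using elim by (simp add: power2_eq_square field_simps)
  qed
  have "filterlim (\<lambda>n. T / real (Suc n)) (at_right 0) sequentially"
    unfolding filterlim_at using \<open>T > 0\<close>
    using LIMSEQ_Suc[OF lim_const_over_n[of T]] by (auto intro!: always_eventually)
  with ev have "\<forall>\<^sub>F n in sequentially.
      norm ((T / real (Suc n) / \<phi> (T / real (Suc n)) - 1) / (T / real (Suc n))) \<le> 2 * C"
    by (rule eventually_compose_filterlim)
  then have "Bseq (\<lambda>n. (T / real (Suc n) / \<phi> (T / real (Suc n)) - 1) / (T / real (Suc n)))"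
    by (rule BfunI)
  then obtain \<Gamma> where "\<Gamma> > 0"
    and \<Gamma>: "\<And>n. norm ((T / real (Suc n) / \<phi> (T / real (Suc n)) - 1) / (T / real (Suc n))) \<le> \<Gamma>"
    by (rule BseqE) blast
  have "\<bar>(T / real N) / \<phi> (T / real N) - 1\<bar> \<le> \<Gamma> * (T / real N)" if "N > 0" for N
  proof -
    have "norm ((T / real N / \<phi> (T / real N) - 1) / (T / real N)) \<le> \<Gamma>"
      using \<Gamma>[of "N - 1"] that by simp
    moreover have "T / real N > 0"
      using that \<open>T > 0\<close> by simp
    ultimately show ?thesis
      by (metis abs_divide abs_of_pos pos_divide_le_eq real_norm_def)
  qed
  then show ?thesis
    using \<open>\<Gamma> > 0\<close> by (intro exI[of _ \<Gamma>]) auto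
qed

section \<open>The photochemical kernel\<close>

text \<open>
  The bound holds because \<open>X \<le> X\<^sup>2 + 1\<close>; it is crude, but uniform in the unbounded argument.
\<close>
lemma rho_bounds:
  assumes "a1 \<ge> 0" "a2 \<ge> 0" "X \<ge> 0"
  shows "0 \<le> rho a1 a2 X" "rho a1 a2 X \<le> a1"
proof -
  have "X \<le> X\<^sup>2 + a2 * X + 1"
  proof -
    have "0 \<le> (X - 1)\<^sup>2" "0 \<le> a2 * X" "0 \<le> X\<^sup>2"
      using assms by auto
    then show ?thesis using \<open>X \<ge> 0\<close> unfolding power2_diff by simp
  qed
  then have "a1 * X \<le> a1 * (X\<^sup>2 + a2 * X + 1)"
    using assms by (intro mult_left_mono)
  moreover have "X\<^sup>2 + a2 * X + 1 > 0"
    using assms by (simp add: add_nonneg_pos)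
  ultimately show "0 \<le> rho a1 a2 X" "rho a1 a2 X \<le> a1"
    using assms unfolding rho_def by (auto simp: pos_divide_le_eq)
qed

text \<open>
  With the denominators \<open>p\<close> and \<open>q\<close> at \<open>X\<close> and \<open>Y\<close>, the terms containing \<open>a2\<close> cancel in
  \<open>X * q - Y * p = (X - Y) * (1 - X * Y)\<close>, and \<open>\<bar>1 - X * Y\<bar> \<le> (1 + X\<^sup>2) * (1 + Y\<^sup>2) \<le> p * q\<close>.
\<close>
lemma rho_lipschitz:
  assumes "a1 \<ge> 0" "a2 \<ge> 0"
  shows "a1-lipschitz_on {0..} (rho a1 a2)"
proof (rule lipschitz_onI)
  fix X Y :: real assume XY: "X \<in> {0..}" "Y \<in> {0..}"
  define p q where "p = X\<^sup>2 + a2 * X + 1" and "q = Y\<^sup>2 + a2 * Y + 1"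
  have p: "p \<ge> X\<^sup>2 + 1" "p > 0" and q: "q \<ge> Y\<^sup>2 + 1" "q > 0"
    using XY assms by (auto simp: p_def q_def add_nonneg_pos)
  have "\<bar>1 - X * Y\<bar> \<le> 1 + X * Y"
    using XY by (auto simp: abs_le_iff)
  also have "\<dots> \<le> (X\<^sup>2 + 1) * (Y\<^sup>2 + 1)"
  proof -
    have "0 \<le> (X - Y)\<^sup>2" "0 \<le> X\<^sup>2" "0 \<le> Y\<^sup>2" "0 \<le> X\<^sup>2 * Y\<^sup>2"
      by auto
    then have "X * Y \<le> X\<^sup>2 * Y\<^sup>2 + X\<^sup>2 + Y\<^sup>2"
      unfolding power2_diff by linarith
    then show ?thesis by (simp add: algebra_simps)
  qed
  also have "\<dots> \<le> p * q"
    using p q by (intro mult_mono) auto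
  finally have le: "\<bar>1 - X * Y\<bar> \<le> p * q" .
  have "rho a1 a2 X - rho a1 a2 Y = (a1 * X * q - a1 * Y * p) / (p * q)"
    using p q unfolding rho_def p_def[symmetric] q_def[symmetric]
    by (simp add: field_simps)
  also have "a1 * X * q - a1 * Y * p = a1 * (X - Y) * (1 - X * Y)"
    by (simp add: p_def q_def algebra_simps power2_eq_square)
  finally have "\<bar>rho a1 a2 X - rho a1 a2 Y\<bar> = a1 * \<bar>X - Y\<bar> * (\<bar>1 - X * Y\<bar> / (p * q))"
    using assms p q by (simp add: abs_mult)
  also have "\<dots> \<le> a1 * \<bar>X - Y\<bar> * 1"
    using le p q assms by (intro mult_left_mono) auto
  finally show "dist (rho a1 a2 X) (rho a1 a2 Y) \<le> a1 * dist X Y"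
    by (simp add: dist_real_def)
qed (use assms in simp)

lemma photo_kernel_bounds:
  assumes "a1 \<ge> 0" "a2 \<ge> 0" "I l \<ge> 0"
  shows "0 \<le> photo_kernel a1 a2 \<mu> I \<epsilon>A \<epsilon>B l y s" "photo_kernel a1 a2 \<mu> I \<epsilon>A \<epsilon>B l y s \<le> a1"
  unfolding photo_kernel_def using assms by (auto intro!: rho_bounds simp: iota_def)

text \<open>
  The kernel is built from Lipschitz functions by sums, products, the exponential and \<open>\<rho>\<close>. Products and the
  exponential preserve the Lipschitz property only for bounded functions, hence the compact box; \<open>\<rho>\<close> is
  only ever applied to nonnegative arguments, as \<open>I \<ge> 0\<close>.
\<close>
lemma photo_kernel_lipschitz:
  assumes "a1 \<ge> 0" "a2 \<ge> 0"
    and C1: "C1_on I lam0 lam1" "C1_on \<epsilon>A lam0 lam1" "C1_on \<epsilon>B lam0 lam1"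
    and I: "\<forall>l\<in>{lam0..lam1}. I l \<ge> 0"
  shows "\<exists>\<Lambda>. \<Lambda>-lipschitz_on ({lam0..lam1} \<times> {-B..B} \<times> {-B..B})
           (\<lambda>(l, y, s). photo_kernel a1 a2 \<mu> I \<epsilon>A \<epsilon>B l y s)"
proof -
  let ?U = "{lam0..lam1} \<times> {-B..B} \<times> {-B..B}"
  have U: "compact ?U"
    by (intro compact_Times compact_Icc)
  have fst: "1-lipschitz_on ?U fst"
    by (rule lipschitz_onI) (auto simp: dist_fst_le)
  have y: "1-lipschitz_on ?U (\<lambda>z. fst (snd z))" and s: "1-lipschitz_on ?U (\<lambda>z. snd (snd z))"
    by (auto intro!: lipschitz_onI order_trans[OF dist_fst_le] order_trans[OF dist_snd_le] dist_snd_le)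
  have lip: "\<exists>C. C-lipschitz_on ?U (\<lambda>z. g (fst z))" if "C1_on g lam0 lam1" for g
  proof -
    obtain C where "C-lipschitz_on {lam0..lam1} g"
      using C1_on_imp_lipschitz[OF \<open>C1_on g lam0 lam1\<close>] ..
    then have "C-lipschitz_on (fst ` ?U) g"
      by (rule lipschitz_on_subset) auto
    from lipschitz_on_compose2[OF fst this] show ?thesis by blast
  qed
  obtain CI CA CB where
    CI: "CI-lipschitz_on ?U (\<lambda>z. I (fst z))" and
    CA: "CA-lipschitz_on ?U (\<lambda>z. \<epsilon>A (fst z))" and
    CB: "CB-lipschitz_on ?U (\<lambda>z. \<epsilon>B (fst z))"
    using lip C1 by meson
  obtain C1 where C1: "C1-lipschitz_on ?U (\<lambda>z. \<epsilon>B (fst z) * fst (snd z))"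
    using lipschitz_mult_compact[OF U CB y] ..
  obtain C2 where C2: "C2-lipschitz_on ?U (\<lambda>z. (\<epsilon>A (fst z) - \<epsilon>B (fst z)) * snd (snd z))"
    using lipschitz_mult_compact[OF U lipschitz_on_diff[OF CA CB] s] ..
  note C3 = lipschitz_on_cmult_real[OF lipschitz_on_add[OF C1 C2], of "- \<mu>"]
  obtain C4 where C4: "C4-lipschitz_on ?U (\<lambda>z. exp (- \<mu> * (\<epsilon>B (fst z) * fst (snd z)
      + (\<epsilon>A (fst z) - \<epsilon>B (fst z)) * snd (snd z))))"
    using lipschitz_exp_compact[OF U C3] ..
  obtain C where C: "C-lipschitz_on ?U (\<lambda>z. iota \<mu> I \<epsilon>A \<epsilon>B (fst z) (fst (snd z)) (snd (snd z)))"
    unfolding iota_def using lipschitz_mult_compact[OF U CI C4] ..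
  have "a1-lipschitz_on ((\<lambda>z. iota \<mu> I \<epsilon>A \<epsilon>B (fst z) (fst (snd z)) (snd (snd z))) ` ?U) (rho a1 a2)"
    by (rule lipschitz_on_subset[OF rho_lipschitz]) (use assms in \<open>auto simp: iota_def\<close>)
  from lipschitz_on_compose2[OF C this] show ?thesis
    unfolding photo_kernel_def case_prod_unfold by blast
qed

section \<open>Regularity of solutions of the integro-differential equation\<close>

text \<open>
  The box for the second and third argument of the kernel has half-width \<open>M * L\<close>, which bounds the integrals
  over subintervals of \<open>{0..L}\<close> of any function bounded by \<open>M\<close>, as well as the corresponding left rectangle sums.
\<close>
locale lipschitz_kernel_solution =
  fixes K :: "real \<Rightarrow> real \<Rightarrow> real \<Rightarrow> real" and lam0 lam1 L T :: real
    and f c0 :: "real \<Rightarrow> real" and c :: "real \<Rightarrow> real \<Rightarrow> real" and M P \<Lambda> F D :: real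
  assumes L_pos: "L > 0" and T_pos: "T > 0" and lam_less: "lam0 < lam1"
    and f_nonneg: "\<And>x. x \<in> {0..L} \<Longrightarrow> 0 \<le> f x" and f_le: "\<And>x. x \<in> {0..L} \<Longrightarrow> f x \<le> F"
    and f_lipschitz: "D-lipschitz_on {0..L} f" and c0_lipschitz: "D-lipschitz_on {0..L} c0"
    and c_bound: "\<And>x t. x \<in> {0..L} \<Longrightarrow> t \<in> {0..T} \<Longrightarrow> \<bar>c x t\<bar> \<le> M"
    and K_nonneg: "\<And>l y s. l \<in> {lam0..lam1} \<Longrightarrow> 0 \<le> K l y s"
    and K_le: "\<And>l y s. l \<in> {lam0..lam1} \<Longrightarrow> K l y s \<le> P"
    and K_lipschitz: "\<Lambda>-lipschitz_on ({lam0..lam1} \<times> {-(M*L)..M*L} \<times> {-(M*L)..M*L})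
      (\<lambda>(l, y, s). K l y s)"
    and solution: "classical_solution K lam0 lam1 f c0 L T c"
begin

abbreviation R :: "real \<Rightarrow> real \<Rightarrow> real" where "R \<equiv> rate K lam0 lam1 c0 c"

abbreviation S :: "real \<Rightarrow> real \<Rightarrow> real" where "S x t \<equiv> integral {0..x} (\<lambda>\<xi>. c \<xi> t)"

definition c_t :: "real \<Rightarrow> real \<Rightarrow> real" where "c_t x t = - c x t * f x * R x t"

abbreviation width :: real where "width \<equiv> lam1 - lam0"

lemma nonneg: "M \<ge> 0" "F \<ge> 0" "P \<ge> 0" "\<Lambda> \<ge> 0" "D \<ge> 0" "M * L \<ge> 0" "width \<ge> 0"
proof -
  show "M \<ge> 0" using c_bound[of 0 0] L_pos T_pos by auto
  then show "M * L \<ge> 0" using L_pos by simp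
  show "F \<ge> 0" using f_nonneg[of 0] f_le[of 0] L_pos by auto
  show "P \<ge> 0" using K_nonneg[of lam0 0 0] K_le[of lam0 0 0] lam_less by auto
  show "\<Lambda> \<ge> 0" "D \<ge> 0" using K_lipschitz f_lipschitz by (auto dest: lipschitz_on_nonneg)
  show "width \<ge> 0" using lam_less by simp
qed

lemma c_continuous: "continuous_on ({0..L} \<times> {0..T}) (\<lambda>(x, t). c x t)"
  and c_deriv: "\<And>x t. x \<in> {0..L} \<Longrightarrow> t \<in> {0..T} \<Longrightarrow>
    ((\<lambda>s. c x s) has_real_derivative c_t x t) (at t within {0..T})"
  and c_initial: "\<And>x. x \<in> {0..L} \<Longrightarrow> c x 0 = c0 x"
  using solution unfolding classical_solution_def c_t_def by auto

lemma c_continuous_space: "t \<in> {0..T} \<Longrightarrow> continuous_on {0..L} (\<lambda>x. c x t)"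
  using continuous_on_compose2[OF c_continuous, of "{0..L}" "\<lambda>x. (x, t)"]
  by (force intro: continuous_intros)

text \<open>
  The distance in the product space is bounded by the sum of the coordinate distances; in this form the
  three sources of error in the kernel can be treated separately.
\<close>
lemma K_diff:
  assumes "l \<in> {lam0..lam1}" "l' \<in> {lam0..lam1}"
    and "\<bar>y\<bar> \<le> M * L" "\<bar>s\<bar> \<le> M * L" "\<bar>y'\<bar> \<le> M * L" "\<bar>s'\<bar> \<le> M * L"
  shows "\<bar>K l y s - K l' y' s'\<bar> \<le> \<Lambda> * (\<bar>l - l'\<bar> + \<bar>y - y'\<bar> + \<bar>s - s'\<bar>)"
proof -
  have "dist (l, y, s) (l', y', s') \<le> dist l l' + dist (y, s) (y', s')"
    unfolding dist_Pair_Pair by (rule sqrt_sum_squares_le_sum) auto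
  also have "dist (y, s) (y', s') \<le> dist y y' + dist s s'"
    unfolding dist_Pair_Pair by (rule sqrt_sum_squares_le_sum) auto
  finally have le: "dist (l, y, s) (l', y', s') \<le> \<bar>l - l'\<bar> + \<bar>y - y'\<bar> + \<bar>s - s'\<bar>"
    by (simp add: dist_real_def)
  have "\<bar>K l y s - K l' y' s'\<bar> \<le> \<Lambda> * dist (l, y, s) (l', y', s')"
    using lipschitz_onD[OF K_lipschitz, of "(l, y, s)" "(l', y', s')"] assms
    by (simp add: dist_real_def abs_le_iff)
  also have "\<dots> \<le> \<Lambda> * (\<bar>l - l'\<bar> + \<bar>y - y'\<bar> + \<bar>s - s'\<bar>)"
    using le nonneg by (intro mult_left_mono)
  finally show ?thesis .
qed

lemma K_lipschitz_lam:
  assumes "\<bar>y\<bar> \<le> M * L" "\<bar>s\<bar> \<le> M * L"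
  shows "\<Lambda>-lipschitz_on {lam0..lam1} (\<lambda>l. K l y s)"
  using assms K_diff[of _ _ y s y s] nonneg by (intro lipschitz_onI) (auto simp: dist_real_def)

lemma K_integrable:
  assumes "\<bar>y\<bar> \<le> M * L" "\<bar>s\<bar> \<le> M * L"
  shows "(\<lambda>l. K l y s) integrable_on {lam0..lam1}"
  using K_lipschitz_lam[OF assms] lipschitz_on_continuous_on integrable_continuous_real by blast

lemma S_lipschitz_space:
  assumes "t \<in> {0..T}" shows "M-lipschitz_on {0..L} (\<lambda>x. S x t)"
  using assms by (intro lipschitz_integral_upper c_continuous_space c_bound nonneg)

lemma C0_lipschitz: "M-lipschitz_on {0..L} (C0 c0)"
proof -
  have "continuous_on {0..L} c0"
    using c0_lipschitz by (rule lipschitz_on_continuous_on)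
  moreover have "\<bar>c0 x\<bar> \<le> M" if "x \<in> {0..L}" for x
    using c_bound[of x 0] c_initial[OF that] that T_pos by auto
  ultimately show ?thesis
    unfolding C0_def using nonneg by (intro lipschitz_integral_upper) auto
qed

lemma integral_bounds:
  assumes "x \<in> {0..L}"
  shows "t \<in> {0..T} \<Longrightarrow> \<bar>S x t\<bar> \<le> M * L" and "\<bar>C0 c0 x\<bar> \<le> M * L"
proof -
  have le: "M * x \<le> M * L"
    using assms nonneg by (intro mult_left_mono) auto
  show "\<bar>S x t\<bar> \<le> M * L" if "t \<in> {0..T}"
    using lipschitz_onD[OF S_lipschitz_space[OF that] assms, of 0] assms le
    by (simp add: dist_real_def)
  show "\<bar>C0 c0 x\<bar> \<le> M * L"
    using lipschitz_onD[OF C0_lipschitz assms, of 0] assms le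
    by (simp add: dist_real_def C0_def)
qed

lemma rate_bounds:
  assumes "x \<in> {0..L}" "t \<in> {0..T}"
  shows "0 \<le> R x t" "R x t \<le> P * width"
proof -
  note int = K_integrable[OF integral_bounds(2) integral_bounds(1), OF assms(1) assms]
  show "0 \<le> R x t"
    unfolding rate_def using int K_nonneg by (intro integral_nonneg) auto
  have "R x t \<le> integral {lam0..lam1} (\<lambda>_. P)"
    unfolding rate_def using int K_le by (intro integral_le) auto
  then show "R x t \<le> P * width"
    using lam_less by (simp add: mult.commute)
qed

text \<open>
  Stated in terms of the integrals rather than of the points, so that it serves for shifts in time and in
  space alike.
\<close>
lemma rate_diff:
  assumes "x \<in> {0..L}" "t \<in> {0..T}" "x' \<in> {0..L}" "t' \<in> {0..T}"
  shows "\<bar>R x t - R x' t'\<bar> \<le> \<Lambda> * (\<bar>C0 c0 x - C0 c0 x'\<bar> + \<bar>S x t - S x' t'\<bar>) * width"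
proof -
  note b = integral_bounds(2)[OF assms(1)] integral_bounds(1)[OF assms(1,2)]
    integral_bounds(2)[OF assms(3)] integral_bounds(1)[OF assms(3,4)]
  note lips = K_lipschitz_lam[OF b(1,2), THEN lipschitz_on_continuous_on]
    K_lipschitz_lam[OF b(3,4), THEN lipschitz_on_continuous_on]
  let ?d = "\<lambda>l. K l (C0 c0 x) (S x t) - K l (C0 c0 x') (S x' t')"
  have "R x t - R x' t' = integral {lam0..lam1} ?d"
    unfolding rate_def using K_integrable b by (subst integral_diff) auto
  moreover have "norm (integral {lam0..lam1} ?d) \<le> \<Lambda> * (\<bar>C0 c0 x - C0 c0 x'\<bar> + \<bar>S x t - S x' t'\<bar>) * width"
    using lam_less b K_diff[of l l "C0 c0 x" "S x t" "C0 c0 x'" "S x' t'" for l]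
    by (intro integral_bound continuous_intros lips) auto
  ultimately show ?thesis by simp
qed

definition c_time_lip :: real where "c_time_lip = M * F * (P * width)"

lemma c_t_bound:
  assumes "x \<in> {0..L}" "t \<in> {0..T}"
  shows "\<bar>c_t x t\<bar> \<le> c_time_lip"
proof -
  have "\<bar>c x t\<bar> * f x * R x t \<le> M * F * (P * width)"
    using assms rate_bounds[OF assms] f_nonneg f_le c_bound nonneg by (intro mult_mono) auto
  then show ?thesis
    using rate_bounds[OF assms] f_nonneg[OF assms(1)] by (simp add: abs_mult c_time_lip_def c_t_def)
qed

lemma c_time_lip_nonneg: "c_time_lip \<ge> 0"
  using nonneg by (simp add: c_time_lip_def)

lemma c_lipschitz_time:
  assumes "x \<in> {0..L}"
  shows "c_time_lip-lipschitz_on {0..T} (c x)"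
proof (rule lipschitz_onI)
  fix t t' assume "t \<in> {0..T}" "t' \<in> {0..T}"
  then show "dist (c x t) (c x t') \<le> c_time_lip * dist t t'"
    unfolding dist_norm
    by (intro field_differentiable_bound[where f' = "c_t x" and S = "{0..T}"] c_deriv)
      (use c_t_bound assms in auto)
qed (rule c_time_lip_nonneg)

lemma S_lipschitz_time:
  assumes x: "x \<in> {0..L}" and t: "t \<in> {0..T}" "t' \<in> {0..T}"
  shows "\<bar>S x t - S x t'\<bar> \<le> c_time_lip * L * \<bar>t - t'\<bar>"
proof -
  have cont: "continuous_on {0..x} (\<lambda>\<xi>. c \<xi> s)" if "s \<in> {0..T}" for s
    using c_continuous_space[OF that] x by (auto elim: continuous_on_subset)
  have "S x t - S x t' = integral {0..x} (\<lambda>\<xi>. c \<xi> t - c \<xi> t')"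
    using cont t by (subst integral_diff) (auto intro: integrable_continuous_real)
  moreover have "norm (integral {0..x} (\<lambda>\<xi>. c \<xi> t - c \<xi> t')) \<le> c_time_lip * \<bar>t - t'\<bar> * (x - 0)"
    using x t lipschitz_onD[OF c_lipschitz_time, of _ t t']
    by (intro integral_bound continuous_intros cont) (auto simp: dist_real_def)
  moreover have "c_time_lip * \<bar>t - t'\<bar> * (x - 0) \<le> c_time_lip * \<bar>t - t'\<bar> * L"
    using x c_time_lip_nonneg by (intro mult_left_mono) auto
  ultimately show ?thesis by (simp add: mult_ac)
qed

definition c_t_time_lip :: real where
  "c_t_time_lip = F * (c_time_lip * (P * width) + M * (\<Lambda> * (c_time_lip * L) * width))"

lemma c_t_time_lip_nonneg: "c_t_time_lip \<ge> 0"
  using nonneg c_time_lip_nonneg L_pos by (simp add: c_t_time_lip_def)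

text \<open>
  The equation expresses \<open>c_t\<close> by \<open>c\<close> and \<open>R\<close>, which are both bounded and Lipschitz in time. This replaces
  a bound on the second time derivative.
\<close>
lemma c_t_lipschitz_time:
  assumes x: "x \<in> {0..L}" and t: "t \<in> {0..T}" "t' \<in> {0..T}"
  shows "\<bar>c_t x t - c_t x t'\<bar> \<le> c_t_time_lip * \<bar>t - t'\<bar>"
proof -
  have R: "\<bar>R x t - R x t'\<bar> \<le> \<Lambda> * (c_time_lip * L * \<bar>t - t'\<bar>) * width"
  proof -
    have "\<bar>R x t - R x t'\<bar> \<le> \<Lambda> * \<bar>S x t - S x t'\<bar> * width"
      using rate_diff[OF x t(1) x t(2)] by simp
    also have "\<dots> \<le> \<Lambda> * (c_time_lip * L * \<bar>t - t'\<bar>) * width"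
      using S_lipschitz_time[OF assms] nonneg by (intro mult_right_mono mult_left_mono)
    finally show ?thesis .
  qed
  have c: "\<bar>c x t - c x t'\<bar> \<le> c_time_lip * \<bar>t - t'\<bar>"
    using lipschitz_onD[OF c_lipschitz_time[OF x] t] by (simp add: dist_real_def)
  have "\<bar>c x t * R x t - c x t' * R x t'\<bar> = \<bar>(c x t - c x t') * R x t + c x t' * (R x t - R x t')\<bar>"
    by (simp add: algebra_simps)
  also have "\<dots> \<le> \<bar>c x t - c x t'\<bar> * \<bar>R x t\<bar> + \<bar>c x t'\<bar> * \<bar>R x t - R x t'\<bar>"
    by (metis abs_mult abs_triangle_ineq)
  also have "\<dots> \<le> c_time_lip * \<bar>t - t'\<bar> * (P * width)
      + M * (\<Lambda> * (c_time_lip * L * \<bar>t - t'\<bar>) * width)"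
    using R c rate_bounds[OF x t(1)] c_bound[OF x t(2)] nonneg c_time_lip_nonneg
    by (intro add_mono mult_mono) auto
  finally have "\<bar>c x t * R x t - c x t' * R x t'\<bar> \<le>
      (c_time_lip * (P * width) + M * (\<Lambda> * (c_time_lip * L) * width)) * \<bar>t - t'\<bar>"
    by (simp add: algebra_simps)
  then have "f x * \<bar>c x t * R x t - c x t' * R x t'\<bar> \<le>
      F * ((c_time_lip * (P * width) + M * (\<Lambda> * (c_time_lip * L) * width)) * \<bar>t - t'\<bar>)"
    using f_nonneg[OF x] f_le[OF x] nonneg by (intro mult_mono) auto
  moreover have "c_t x t - c_t x t' = - (f x * (c x t * R x t - c x t' * R x t'))"
    by (simp add: c_t_def algebra_simps)
  ultimately show ?thesis
    unfolding c_t_time_lip_def using f_nonneg[OF x] by (simp add: abs_mult mult.assoc)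
qed

lemma forward_difference_error:
  assumes x: "x \<in> {0..L}" and t: "t \<in> {0..T}" "t + h \<in> {0..T}" and "h \<ge> 0"
  shows "\<bar>c x (t + h) - c x t - h * c_t x t\<bar> \<le> c_t_time_lip * h * h"
proof -
  have "\<exists>\<tau>\<in>{t..t + h}. c x (t + h) - c x t = c_t x \<tau> * (t + h - t)"
    by (rule mean_value_within[OF _ _ c_deriv[OF x]]) (use t \<open>h \<ge> 0\<close> in auto)
  then obtain \<tau> where \<tau>: "\<tau> \<in> {t..t + h}" "c x (t + h) - c x t = c_t x \<tau> * h"
    by auto
  have "\<bar>c x (t + h) - c x t - h * c_t x t\<bar> = \<bar>(c_t x \<tau> - c_t x t) * h\<bar>"
    unfolding \<tau>(2) by (simp only: left_diff_distrib mult.commute[of h])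
  also have "\<dots> \<le> (c_t_time_lip * h) * h"
  proof -
    have "\<bar>c_t x \<tau> - c_t x t\<bar> \<le> c_t_time_lip * \<bar>\<tau> - t\<bar>"
      using \<tau> assms by (intro c_t_lipschitz_time) auto
    also have "\<dots> \<le> c_t_time_lip * h"
      using \<tau> c_t_time_lip_nonneg by (intro mult_left_mono) auto
    finally show ?thesis
      unfolding abs_mult using \<open>h \<ge> 0\<close> by (simp add: mult_right_mono)
  qed
  finally show ?thesis .
qed

definition source_lip :: real where
  "source_lip = M * (D * (P * width) + F * (\<Lambda> * (2 * M) * width))"

text \<open>
  The constant from the Gronwall estimate below: \<open>D\<close> is the contribution of the initial values, \<open>source_lip\<close>
  that of the inhomogeneity, which acts for a time of at most \<open>T\<close>.
\<close>
definition c_space_lip :: real where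
  "c_space_lip = sqrt (exp T * (D\<^sup>2 + T * source_lip\<^sup>2))"

text \<open>
  The difference \<open>w\<close> of \<open>c\<close> at \<open>x\<close> and \<open>x'\<close> has the time derivative \<open>- f x * R x t * w t - g\<close>, where \<open>g\<close> is
  the quantity estimated here.
\<close>
lemma decay_coefficient_diff:
  assumes x: "x \<in> {0..L}" "x' \<in> {0..L}" and t: "t \<in> {0..T}"
  shows "\<bar>(f x * R x t - f x' * R x' t) * c x' t\<bar> \<le> source_lip * \<bar>x - x'\<bar>"
proof -
  have R: "\<bar>R x t - R x' t\<bar> \<le> \<Lambda> * (2 * M * \<bar>x - x'\<bar>) * width"
  proof -
    have "\<bar>C0 c0 x - C0 c0 x'\<bar> \<le> M * \<bar>x - x'\<bar>" "\<bar>S x t - S x' t\<bar> \<le> M * \<bar>x - x'\<bar>"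
      using lipschitz_onD[OF C0_lipschitz x] lipschitz_onD[OF S_lipschitz_space[OF t] x]
      by (auto simp: dist_real_def)
    then have "\<Lambda> * (\<bar>C0 c0 x - C0 c0 x'\<bar> + \<bar>S x t - S x' t\<bar>) * width
        \<le> \<Lambda> * (2 * M * \<bar>x - x'\<bar>) * width"
      using nonneg by (intro mult_right_mono mult_left_mono) auto
    with rate_diff[OF x(1) t x(2) t] show ?thesis by linarith
  qed
  have f: "\<bar>f x - f x'\<bar> \<le> D * \<bar>x - x'\<bar>"
    using lipschitz_onD[OF f_lipschitz x] by (simp add: dist_real_def)
  have "\<bar>f x * R x t - f x' * R x' t\<bar> = \<bar>(f x - f x') * R x t + f x' * (R x t - R x' t)\<bar>"
    by (simp add: algebra_simps)
  also have "\<dots> \<le> \<bar>f x - f x'\<bar> * \<bar>R x t\<bar> + \<bar>f x'\<bar> * \<bar>R x t - R x' t\<bar>"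
    by (metis abs_mult abs_triangle_ineq)
  also have "\<dots> \<le> D * \<bar>x - x'\<bar> * (P * width) + F * (\<Lambda> * (2 * M * \<bar>x - x'\<bar>) * width)"
    using R f rate_bounds[OF x(1) t] f_nonneg[OF x(2)] f_le[OF x(2)] nonneg
    by (intro add_mono mult_mono) auto
  also have "\<dots> = (D * (P * width) + F * (\<Lambda> * (2 * M) * width)) * \<bar>x - x'\<bar>"
    by (simp add: algebra_simps)
  finally have "\<bar>f x * R x t - f x' * R x' t\<bar> * \<bar>c x' t\<bar>
      \<le> ((D * (P * width) + F * (\<Lambda> * (2 * M) * width)) * \<bar>x - x'\<bar>) * M"
    using c_bound[OF x(2) t] nonneg by (intro mult_mono) auto
  then show ?thesis
    by (simp add: abs_mult source_lip_def mult_ac)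
qed

text \<open>
  A Gronwall argument. The difference \<open>w\<close> of \<open>c\<close> at two points satisfies \<open>w' = - k * w - g\<close> with \<open>k \<ge> 0\<close> and
  \<open>\<bar>g\<bar> \<le> b\<close>. Hence \<open>(w\<^sup>2)' \<le> - 2 * w * g \<le> w\<^sup>2 + b\<^sup>2\<close>, and \<open>w\<^sup>2 * exp (- s) - b\<^sup>2 * s\<close> is
  nonincreasing in \<open>s\<close>. The square avoids the absolute value, which need not be differentiable.
\<close>
lemma c_lipschitz_space:
  assumes "t \<in> {0..T}"
  shows "c_space_lip-lipschitz_on {0..L} (\<lambda>x. c x t)"
proof (rule lipschitz_onI)
  show "0 \<le> c_space_lip"
    using T_pos by (simp add: c_space_lip_def)
  fix x x' assume x: "x \<in> {0..L}" "x' \<in> {0..L}"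
  define w where "w s = c x s - c x' s" for s
  define b where "b = source_lip * \<bar>x - x'\<bar>"
  define v where "v s = (w s)\<^sup>2 * exp (- s) - b\<^sup>2 * s" for s
  define v' where "v' s = 2 * w s * (c_t x s - c_t x' s) * exp (- s) - (w s)\<^sup>2 * exp (- s) - b\<^sup>2" for s
  have v': "(v has_real_derivative v' s) (at s within {0..T})" if "s \<in> {0..T}" for s
  proof -
    have "(w has_real_derivative c_t x s - c_t x' s) (at s within {0..T})"
      unfolding w_def[abs_def] by (intro DERIV_diff c_deriv x that)
    from DERIV_diff[OF DERIV_mult[OF DERIV_power[OF this, of 2]
          has_field_derivative_at_within[OF DERIV_fun_exp[OF DERIV_minus[OF DERIV_ident]]]]
        DERIV_cmult[OF DERIV_ident]]
    show ?thesis
      unfolding v_def[abs_def] by (rule DERIV_cong) (simp add: v'_def algebra_simps)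
  qed
  have v'_nonpos: "v' s \<le> 0" if s: "s \<in> {0..T}" for s
  proof -
    define g where "g = (f x * R x s - f x' * R x' s) * c x' s"
    have c_t_diff: "c_t x s - c_t x' s = - (f x * R x s) * w s - g"
      by (simp add: w_def g_def c_t_def algebra_simps)
    have "2 * w s * (c_t x s - c_t x' s) = - 2 * (f x * R x s) * (w s)\<^sup>2 - 2 * w s * g"
      unfolding c_t_diff by (simp add: algebra_simps power2_eq_square)
    also have "\<dots> \<le> - 2 * w s * g"
      using f_nonneg[OF x(1)] rate_bounds[OF x(1) s] by simp
    also have "\<dots> \<le> (w s)\<^sup>2 + g\<^sup>2"
      using zero_le_power2[of "w s + g"] by (simp add: power2_sum)
    finally have "(2 * w s * (c_t x s - c_t x' s) - (w s)\<^sup>2) * exp (- s) \<le> g\<^sup>2 * exp (- s)"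
      by (intro mult_right_mono) auto
    also have "\<dots> \<le> g\<^sup>2"
      using s by (simp add: mult_left_le)
    also have "\<dots> \<le> b\<^sup>2"
      using decay_coefficient_diff[OF x s] unfolding g_def b_def
      by (subst power2_abs[of "_ * _", symmetric]) (rule power_mono, auto)
    finally show ?thesis
      by (simp add: v'_def algebra_simps)
  qed
  have "v t \<le> v 0"
  proof -
    have "\<exists>\<tau>\<in>{0..t}. v t - v 0 = v' \<tau> * (t - 0)"
      by (rule mean_value_within[OF _ _ v']) (use assms in auto)
    then obtain \<tau> where "\<tau> \<in> {0..t}" "v t - v 0 = v' \<tau> * t"
      by auto
    then show ?thesis
      using v'_nonpos[of \<tau>] assms mult_nonpos_nonneg[of "v' \<tau>" t] by auto
  qed
  then have "(w t)\<^sup>2 * exp (- t) \<le> (w 0)\<^sup>2 + b\<^sup>2 * t"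
    by (simp add: v_def)
  also have "\<dots> \<le> (D * \<bar>x - x'\<bar>)\<^sup>2 + b\<^sup>2 * T"
  proof (intro add_mono mult_left_mono)
    have "\<bar>w 0\<bar> \<le> D * \<bar>x - x'\<bar>"
      using lipschitz_onD[OF c0_lipschitz x] c_initial x by (simp add: w_def dist_real_def)
    then show "(w 0)\<^sup>2 \<le> (D * \<bar>x - x'\<bar>)\<^sup>2"
      by (metis abs_ge_zero power2_abs power_mono)
  qed (use assms in auto)
  also have "\<dots> = (D\<^sup>2 + T * source_lip\<^sup>2) * \<bar>x - x'\<bar>\<^sup>2"
    by (simp add: b_def power_mult_distrib algebra_simps)
  finally have "(w t)\<^sup>2 \<le> exp t * ((D\<^sup>2 + T * source_lip\<^sup>2) * \<bar>x - x'\<bar>\<^sup>2)"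
    by (simp add: exp_minus field_simps)
  also have "\<dots> \<le> exp T * ((D\<^sup>2 + T * source_lip\<^sup>2) * \<bar>x - x'\<bar>\<^sup>2)"
    using assms T_pos by (intro mult_right_mono) auto
  also have "\<dots> = (c_space_lip * \<bar>x - x'\<bar>)\<^sup>2"
    using T_pos by (simp add: c_space_lip_def power_mult_distrib)
  finally have "\<bar>w t\<bar> \<le> \<bar>c_space_lip * \<bar>x - x'\<bar>\<bar>"
    by (simp add: abs_le_square_iff)
  then show "dist (c x t) (c x' t) \<le> c_space_lip * dist x x'"
    using \<open>0 \<le> c_space_lip\<close> by (simp add: w_def dist_real_def abs_mult)
qed

section \<open>The local truncation error\<close>

text \<open>
  Let \<open>s\<close> be the left rectangle sum for \<open>S x t\<close>. Its error is of order \<open>dx\<close>, because \<open>c\<close> is Lipschitz in space, and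
  the kernel passes it on multiplied by \<open>\<Lambda>\<close>. The wavelength sum is compared with the integral for this
  same \<open>s\<close>, which costs an error of order \<open>dlam\<close>. For the kernel bounds to apply at \<open>s\<close>, it must lie in the box.
\<close>
lemma quadrature_error:
  fixes j N :: nat
  assumes t: "t \<in> {0..T}" and dx: "dx \<ge> 0" "real j * dx \<le> L"
    and N: "N > 0" "dlam = width / real N"
  defines "x \<equiv> real j * dx"
  defines "Q \<equiv> dlam * (\<Sum>l<N. K (lam0 + real l * dlam) (C0 c0 x) (dx * (\<Sum>r<j. c (real r * dx) t)))"
  shows "\<bar>Q\<bar> \<le> P * width" "\<bar>Q - R x t\<bar> \<le> \<Lambda> * width * (dlam + c_space_lip * L * dx)"
proof -
  define s where "s = dx * (\<Sum>r<j. c (real r * dx) t)"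
  have x: "x \<in> {0..L}"
    using dx by (simp add: x_def)
  have dlam: "dlam > 0" "real N * dlam = width"
    using N lam_less by auto
  have lam: "lam0 + real l * dlam \<in> {lam0..lam1}" if "l < N" for l
  proof -
    have "real l * dlam \<le> real N * dlam"
      using that dlam by (intro mult_right_mono) auto
    then show ?thesis using dlam by auto
  qed
  have c_space_lip_nonneg: "c_space_lip \<ge> 0"
    using c_lipschitz_space[OF t] by (rule lipschitz_on_nonneg)

  have s_bound: "\<bar>s\<bar> \<le> M * L"
  proof -
    have "\<bar>c (real r * dx) t\<bar> \<le> M" if "r < j" for r
    proof -
      have "real r * dx \<le> real j * dx"
        using that dx by (intro mult_right_mono) auto
      then show ?thesis using dx t by (intro c_bound) auto
    qed
    then have "\<bar>\<Sum>r<j. c (real r * dx) t\<bar> \<le> real j * M"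
      using sum_bounded_above[of "{..<j}" "\<lambda>r. \<bar>c (real r * dx) t\<bar>" M]
      by (intro order_trans[OF sum_abs]) auto
    then have "dx * \<bar>\<Sum>r<j. c (real r * dx) t\<bar> \<le> dx * (real j * M)"
      using dx by (intro mult_left_mono)
    also have "\<dots> \<le> M * L"
      using mult_left_mono[OF dx(2), of M] nonneg by (simp add: mult_ac)
    finally show ?thesis
      using dx by (simp add: s_def abs_mult)
  qed
  have s_error: "\<bar>s - S x t\<bar> \<le> c_space_lip * L * dx"
  proof -
    have "c_space_lip-lipschitz_on {0..0 + real j * dx} (\<lambda>x. c x t)"
      by (rule lipschitz_on_subset[OF c_lipschitz_space[OF t]]) (use dx in auto)
    from left_rectangle_rule_error[OF dx(1) this]
    have "\<bar>s - S x t\<bar> \<le> c_space_lip * (real j * dx) * dx"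
      by (simp add: s_def x_def)
    also have "\<dots> \<le> c_space_lip * L * dx"
      using dx c_space_lip_nonneg by (intro mult_right_mono mult_left_mono)
    finally show ?thesis .
  qed
  have Q: "Q = dlam * (\<Sum>l<N. K (lam0 + real l * dlam) (C0 c0 x) s)"
    by (simp add: Q_def s_def)

  have "(\<Sum>l<N. K (lam0 + real l * dlam) (C0 c0 x) s) \<ge> 0"
    using K_nonneg lam by (intro sum_nonneg) auto
  moreover have "(\<Sum>l<N. K (lam0 + real l * dlam) (C0 c0 x) s) \<le> real N * P"
    using sum_bounded_above[of "{..<N}" "\<lambda>l. K (lam0 + real l * dlam) (C0 c0 x) s" P] K_le lam
    by auto
  ultimately have "\<bar>Q\<bar> \<le> dlam * (real N * P)"
    unfolding Q using dlam by (simp add: abs_mult)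
  also have "\<dots> = P * width"
    using dlam(2) by (simp add: mult_ac)
  finally show "\<bar>Q\<bar> \<le> P * width" .

  note y_bound = integral_bounds(2)[OF x] and S_bound = integral_bounds(1)[OF x t]
  have eq: "lam0 + real N * dlam = lam1"
    using dlam by simp
  have "\<bar>Q - integral {lam0..lam1} (\<lambda>l. K l (C0 c0 x) s)\<bar> \<le> \<Lambda> * width * dlam"
    using left_rectangle_rule_error[of dlam \<Lambda> lam0 N "\<lambda>l. K l (C0 c0 x) s"]
      K_lipschitz_lam[OF y_bound s_bound] dlam unfolding eq Q by simp
  moreover have "\<bar>integral {lam0..lam1} (\<lambda>l. K l (C0 c0 x) s) - R x t\<bar>
      \<le> \<Lambda> * (c_space_lip * L * dx) * width"
  proof -
    let ?d = "\<lambda>l. K l (C0 c0 x) s - K l (C0 c0 x) (S x t)"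
    have "norm (integral {lam0..lam1} ?d) \<le> \<Lambda> * (c_space_lip * L * dx) * width"
    proof (rule integral_bound)
      fix l assume "l \<in> {lam0..lam1}"
      then have "\<bar>?d l\<bar> \<le> \<Lambda> * \<bar>s - S x t\<bar>"
        using K_diff[of l l "C0 c0 x" s "C0 c0 x" "S x t"] y_bound s_bound S_bound by simp
      also have "\<dots> \<le> \<Lambda> * (c_space_lip * L * dx)"
        using s_error nonneg by (intro mult_left_mono)
      finally show "norm (?d l) \<le> \<Lambda> * (c_space_lip * L * dx)" by simp
    next
      show "continuous_on {lam0..lam1} ?d"
        using K_lipschitz_lam[OF y_bound s_bound] K_lipschitz_lam[OF y_bound S_bound]
        by (intro continuous_on_diff lipschitz_on_continuous_on)
    qed (use lam_less in auto)
    moreover have "integral {lam0..lam1} ?d = integral {lam0..lam1} (\<lambda>l. K l (C0 c0 x) s) - R x t"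
      unfolding rate_def using K_integrable y_bound s_bound S_bound by (intro integral_diff)
    ultimately show ?thesis by simp
  qed
  ultimately have "\<bar>Q - R x t\<bar> \<le> \<Lambda> * width * dlam + \<Lambda> * (c_space_lip * L * dx) * width"
    by linarith
  then show "\<bar>Q - R x t\<bar> \<le> \<Lambda> * width * (dlam + c_space_lip * L * dx)"
    by (simp add: algebra_simps)
qed

lemma model_residual_eq_0:
  assumes "x \<in> {0..L}" "t \<in> {0..T}"
  shows "model_residual K lam0 lam1 f c0 T c x t = 0"
proof -
  have "time_deriv T c x t = c_t x t"
    unfolding time_deriv_def using T_pos assms c_deriv
    by (intro vector_derivative_within_closed_interval)
      (auto simp: has_real_derivative_iff_has_vector_derivative)
  then show ?thesis
    by (simp add: model_residual_def c_t_def)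
qed

text \<open>
  With \<open>h\<close> in place of the denominator \<open>p\<close> this is the error of the forward difference; the change of the
  denominator contributes \<open>c_t x t * (h / p - 1)\<close>.
\<close>
lemma weighted_difference_error:
  assumes x: "x \<in> {0..L}" and t: "t \<in> {0..T}" "t + h \<in> {0..T}" and "h \<ge> 0"
    and "p > 0" "\<bar>h / p - 1\<bar> \<le> \<Gamma> * h" "\<Gamma> \<ge> 0"
  shows "\<bar>(c x (t + h) - c x t) / p - c_t x t\<bar> \<le> (c_t_time_lip * (1 + \<Gamma> * T) + c_time_lip * \<Gamma>) * h"
proof -
  have "h / p \<le> 1 + \<Gamma> * h"
    using assms by linarith
  also have "\<dots> \<le> 1 + \<Gamma> * T"
    using t \<open>\<Gamma> \<ge> 0\<close> by (auto intro!: mult_left_mono)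
  finally have ratio: "h / p \<le> 1 + \<Gamma> * T" .
  have split: "(c x (t + h) - c x t) / p - c_t x t
      = (c x (t + h) - c x t - h * c_t x t) / p + c_t x t * (h / p - 1)"
    using \<open>p > 0\<close> by (simp add: field_simps)
  have "\<bar>(c x (t + h) - c x t - h * c_t x t) / p\<bar> \<le> c_t_time_lip * h * (1 + \<Gamma> * T)"
  proof -
    have "\<bar>c x (t + h) - c x t - h * c_t x t\<bar> / p \<le> c_t_time_lip * h * h / p"
      using assms by (intro divide_right_mono forward_difference_error) auto
    also have "\<dots> = c_t_time_lip * h * (h / p)"
      by simp
    also have "\<dots> \<le> c_t_time_lip * h * (1 + \<Gamma> * T)"
      using ratio c_t_time_lip_nonneg \<open>h \<ge> 0\<close> by (intro mult_left_mono) auto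
    finally show ?thesis
      using \<open>p > 0\<close> by (simp add: abs_divide)
  qed
  moreover have "\<bar>c_t x t * (h / p - 1)\<bar> \<le> c_time_lip * (\<Gamma> * h)"
    unfolding abs_mult using c_t_bound[OF x t(1)] assms c_time_lip_nonneg by (intro mult_mono) auto
  ultimately have "\<bar>(c x (t + h) - c x t) / p - c_t x t\<bar>
      \<le> c_t_time_lip * h * (1 + \<Gamma> * T) + c_time_lip * (\<Gamma> * h)"
    unfolding split by (intro order_trans[OF abs_triangle_ineq] add_mono)
  then show ?thesis
    by (simp add: algebra_simps)
qed

text \<open>
  As \<open>c_t\<close> stands for minus the exact reaction term, the left-hand side is the difference between the
  discrete reaction term, which is implicit in \<open>c\<close> and explicit in \<open>Q\<close>, and the exact one.
\<close>
lemma reaction_term_error: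
  assumes x: "x \<in> {0..L}" and t: "t \<in> {0..T}" "t + h \<in> {0..T}" and "h \<ge> 0"
    and Q: "\<bar>Q\<bar> \<le> P * width" "\<bar>Q - R x t\<bar> \<le> e"
  shows "\<bar>c x (t + h) * f x * Q + c_t x t\<bar> \<le> F * (c_time_lip * (P * width) * h + M * e)"
proof -
  have "c x (t + h) * f x * Q + c_t x t = f x * ((c x (t + h) - c x t) * Q + c x t * (Q - R x t))"
    by (simp add: c_t_def algebra_simps)
  moreover have "\<bar>(c x (t + h) - c x t) * Q + c x t * (Q - R x t)\<bar>
      \<le> c_time_lip * (P * width) * h + M * e"
  proof -
    have "\<bar>c x (t + h) - c x t\<bar> \<le> c_time_lip * h"
      using lipschitz_onD[OF c_lipschitz_time[OF x] t(2,1)] \<open>h \<ge> 0\<close> by (simp add: dist_real_def)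
    then have "\<bar>c x (t + h) - c x t\<bar> * \<bar>Q\<bar> \<le> c_time_lip * h * (P * width)"
      using Q c_time_lip_nonneg \<open>h \<ge> 0\<close> by (intro mult_mono) auto
    moreover have "\<bar>c x t\<bar> * \<bar>Q - R x t\<bar> \<le> M * e"
      using Q c_bound[OF x t(1)] nonneg by (intro mult_mono) auto
    ultimately show ?thesis
      using abs_triangle_ineq[of "(c x (t + h) - c x t) * Q" "c x t * (Q - R x t)"]
      by (simp add: abs_mult mult_ac)
  qed
  ultimately show ?thesis
    unfolding abs_mult using f_nonneg[OF x] f_le[OF x] nonneg
    by (simp only: abs_mult) (intro mult_mono, auto)
qed

theorem nsfd_consistent:
  assumes pos: "\<forall>h>0. \<phi> h > 0" and "(\<lambda>h. \<phi> h - h) \<in> O[at_right 0](\<lambda>h. h\<^sup>2)"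
  shows "\<exists>\<kappa>>0. \<forall>Nx Nt Nlam j n. Nx > 0 \<longrightarrow> Nt > 0 \<longrightarrow> Nlam > 0 \<longrightarrow> j \<le> Nx \<longrightarrow> n < Nt \<longrightarrow>
    \<bar>truncation_error K lam0 lam1 f c0 T \<phi> c (T / real Nt) (L / real Nx) (width / real Nlam) Nlam j n\<bar>
      \<le> \<kappa> * (T / real Nt + L / real Nx + width / real Nlam)"
proof -
  obtain \<Gamma> where \<Gamma>: "\<Gamma> \<ge> 0" "\<And>N. N > 0 \<Longrightarrow> \<bar>(T / real N) / \<phi> (T / real N) - 1\<bar> \<le> \<Gamma> * (T / real N)"
    using denominator_function_bound[OF T_pos assms] by blast
  define \<kappa>t where "\<kappa>t = c_t_time_lip * (1 + \<Gamma> * T) + c_time_lip * \<Gamma> + F * (c_time_lip * (P * width))"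
  define \<kappa>l where "\<kappa>l = F * (M * (\<Lambda> * width))"
  define \<kappa>x where "\<kappa>x = F * (M * (\<Lambda> * width * (c_space_lip * L)))"
  have "c_space_lip \<ge> 0"
    using T_pos by (simp add: c_space_lip_def)
  then have \<kappa>_nonneg: "\<kappa>t \<ge> 0" "\<kappa>l \<ge> 0" "\<kappa>x \<ge> 0"
    using nonneg c_t_time_lip_nonneg c_time_lip_nonneg \<Gamma>(1) T_pos L_pos
    by (auto simp: \<kappa>t_def \<kappa>l_def \<kappa>x_def)
  show ?thesis
  proof (intro exI[of _ "\<kappa>t + \<kappa>x + \<kappa>l + 1"] conjI allI impI)
    fix Nx Nt Nlam j n :: nat
    assume N: "Nx > 0" "Nt > 0" "Nlam > 0" and j: "j \<le> Nx" and n: "n < Nt"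
    define dt dx dlam x t where "dt = T / real Nt" and "dx = L / real Nx"
      and "dlam = width / real Nlam" and "x = real j * dx" and "t = real n * dt"
    have steps: "dt > 0" "dx > 0" "dlam > 0"
      using N T_pos L_pos lam_less by (auto simp: dt_def dx_def dlam_def)
    have "real j * dx \<le> real Nx * dx"
      using j steps by (intro mult_right_mono) auto
    then have x_le: "real j * dx \<le> L"
      using N by (simp add: dx_def)
    then have x: "x \<in> {0..L}"
      using steps by (simp add: x_def)
    have "real (Suc n) * dt \<le> real Nt * dt"
      using n steps by (intro mult_right_mono) auto
    then have "t + dt \<le> T"
      using N by (simp add: t_def dt_def field_simps)
    moreover have "t \<ge> 0"
      using steps by (simp add: t_def)
    ultimately have t: "t \<in> {0..T}" "t + dt \<in> {0..T}"
      using steps by auto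
    define Q where
      "Q = dlam * (\<Sum>l<Nlam. K (lam0 + real l * dlam) (C0 c0 x) (dx * (\<Sum>r<j. c (real r * dx) t)))"
    have Q: "\<bar>Q\<bar> \<le> P * width" "\<bar>Q - R x t\<bar> \<le> \<Lambda> * width * (dlam + c_space_lip * L * dx)"
      using quadrature_error[OF t(1) _ x_le N(3) dlam_def] steps unfolding Q_def x_def by auto
    have next_t: "real (n + 1) * dt = t + dt"
      by (simp add: t_def algebra_simps)
    have "truncation_error K lam0 lam1 f c0 T \<phi> c dt dx dlam Nlam j n =
      - (((c x (t + dt) - c x t) / \<phi> dt - c_t x t) + (c x (t + dt) * f x * Q + c_t x t))"
      using model_residual_eq_0[OF x t(1)]
      unfolding truncation_error_def nsfd_residual_def next_t x_def[symmetric] t_def[symmetric] Q_def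
      by simp
    moreover have "\<bar>(c x (t + dt) - c x t) / \<phi> dt - c_t x t\<bar>
        \<le> (c_t_time_lip * (1 + \<Gamma> * T) + c_time_lip * \<Gamma>) * dt"
      using steps pos \<Gamma>(1) \<Gamma>(2)[OF N(2)] unfolding dt_def[symmetric]
      by (intro weighted_difference_error x t) auto
    moreover have "\<bar>c x (t + dt) * f x * Q + c_t x t\<bar>
        \<le> F * (c_time_lip * (P * width) * dt + M * (\<Lambda> * width * (dlam + c_space_lip * L * dx)))"
      using steps by (intro reaction_term_error x t Q) auto
    moreover have "\<kappa>t * dt + \<kappa>x * dx + \<kappa>l * dlam
        = (c_t_time_lip * (1 + \<Gamma> * T) + c_time_lip * \<Gamma>) * dt
          + F * (c_time_lip * (P * width) * dt + M * (\<Lambda> * width * (dlam + c_space_lip * L * dx)))"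
      unfolding \<kappa>t_def \<kappa>l_def \<kappa>x_def by (simp add: algebra_simps)
    ultimately have "\<bar>truncation_error K lam0 lam1 f c0 T \<phi> c dt dx dlam Nlam j n\<bar>
        \<le> \<kappa>t * dt + \<kappa>x * dx + \<kappa>l * dlam"
      by linarith
    also have "\<dots> \<le> (\<kappa>t + \<kappa>x + \<kappa>l + 1) * dt + (\<kappa>t + \<kappa>x + \<kappa>l + 1) * dx + (\<kappa>t + \<kappa>x + \<kappa>l + 1) * dlam"
      using \<kappa>_nonneg steps by (intro add_mono mult_right_mono) auto
    finally show "\<bar>truncation_error K lam0 lam1 f c0 T \<phi> c (T / real Nt) (L / real Nx)
        (width / real Nlam) Nlam j n\<bar>
      \<le> (\<kappa>t + \<kappa>x + \<kappa>l + 1) * (T / real Nt + L / real Nx + width / real Nlam)"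
      unfolding dt_def dx_def dlam_def by (simp only: distrib_left)
  qed (use \<kappa>_nonneg in auto)
qed

end

section \<open>Consistency of the NSFD method\<close>

theorem lemma3p2:
  fixes L T lam0 lam1 \<mu> a1 a2 :: real
    and f c0 I \<epsilon>A \<epsilon>B \<phi> :: "real \<Rightarrow> real"
    and c :: "real \<Rightarrow> real \<Rightarrow> real"
  assumes "L > 0" "T > 0" "lam0 < lam1" "\<mu> > 0" "a1 > 0" "a2 \<ge> 0"
    and "C1_on f 0 L" "C1_on c0 0 L"
    and "C1_on I lam0 lam1" "C1_on \<epsilon>A lam0 lam1" "C1_on \<epsilon>B lam0 lam1"
    and "\<forall>x\<in>{0..L}. f x \<ge> 0"
    and "\<forall>l\<in>{lam0..lam1}. 0 \<le> I l \<and> I l \<le> 1"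
    and "\<forall>x\<in>{0..L}. c0 x > 0"
    and "\<forall>h>0. \<phi> h > 0"
    and "(\<lambda>h. \<phi> h - h) \<in> O[at_right 0](\<lambda>h. h\<^sup>2)"
    and "classical_solution (photo_kernel a1 a2 \<mu> I \<epsilon>A \<epsilon>B) lam0 lam1 f c0 L T c"
  shows "\<exists>\<kappa>>0. \<forall>Nx Nt Nlam :: nat. \<forall>dx dt dlam :: real.
           Nx > 0 \<and> Nt > 0 \<and> Nlam > 0 \<and>
           dx = L / real Nx \<and> dt = T / real Nt \<and> dlam = (lam1 - lam0) / real Nlam \<longrightarrow>
           (MAX (n, j)\<in>{0..Nt - 1} \<times> {0..Nx}.
              \<bar>truncation_error (photo_kernel a1 a2 \<mu> I \<epsilon>A \<epsilon>B) lam0 lam1 f c0 T \<phi> c dt dx dlam Nlam j n\<bar>)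
           \<le> \<kappa> * (dt + dx + dlam)"
proof -
  let ?K = "photo_kernel a1 a2 \<mu> I \<epsilon>A \<epsilon>B"
  have "compact ((\<lambda>(x, t). c x t) ` ({0..L} \<times> {0..T}))"
    using assms(17) unfolding classical_solution_def
    by (intro compact_continuous_image compact_Times compact_Icc) auto
  then have "bounded ((\<lambda>(x, t). c x t) ` ({0..L} \<times> {0..T}))"
    by (rule compact_imp_bounded)
  then obtain M where M: "\<And>x t. x \<in> {0..L} \<Longrightarrow> t \<in> {0..T} \<Longrightarrow> \<bar>c x t\<bar> \<le> M"
    unfolding bounded_iff by fastforce
  obtain \<Lambda> where \<Lambda>: "\<Lambda>-lipschitz_on ({lam0..lam1} \<times> {-(M*L)..M*L} \<times> {-(M*L)..M*L})
      (\<lambda>(l, y, s). ?K l y s)"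
    using photo_kernel_lipschitz[of a1 a2 I lam0 lam1 \<epsilon>A \<epsilon>B "M * L" \<mu>] assms by auto
  obtain Df Dc where Df: "Df-lipschitz_on {0..L} f" and Dc: "Dc-lipschitz_on {0..L} c0"
    using C1_on_imp_lipschitz assms(7,8) by meson
  have "bounded (f ` {0..L})"
    using lipschitz_on_continuous_on[OF Df]
    by (intro compact_imp_bounded compact_continuous_image compact_Icc)
  then obtain F where F: "\<And>x. x \<in> {0..L} \<Longrightarrow> \<bar>f x\<bar> \<le> F"
    unfolding bounded_iff by fastforce
  interpret lipschitz_kernel_solution ?K lam0 lam1 L T f c0 c M a1 \<Lambda> F "max Df Dc"
  proof
    show "(max Df Dc)-lipschitz_on {0..L} f" "(max Df Dc)-lipschitz_on {0..L} c0"
      using Df Dc by (auto intro: lipschitz_on_mono)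
    show "f x \<le> F" if "x \<in> {0..L}" for x
      using F[OF that] by simp
  qed (use assms M \<Lambda> in \<open>auto intro: photo_kernel_bounds\<close>)
  obtain \<kappa> where "\<kappa> > 0" and \<kappa>: "\<And>Nx Nt Nlam j n. Nx > 0 \<Longrightarrow> Nt > 0 \<Longrightarrow> Nlam > 0 \<Longrightarrow>
    j \<le> Nx \<Longrightarrow> n < Nt \<Longrightarrow>
    \<bar>truncation_error ?K lam0 lam1 f c0 T \<phi> c (T / real Nt) (L / real Nx) (width / real Nlam) Nlam j n\<bar>
      \<le> \<kappa> * (T / real Nt + L / real Nx + width / real Nlam)"
    using nsfd_consistent[OF assms(15,16)] by blast
  show ?thesis
  proof (intro exI[of _ \<kappa>] conjI allI impI, fact)
    fix Nx Nt Nlam :: nat and dx dt dlam :: real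
    assume H: "Nx > 0 \<and> Nt > 0 \<and> Nlam > 0 \<and>
      dx = L / real Nx \<and> dt = T / real Nt \<and> dlam = (lam1 - lam0) / real Nlam"
    show "(MAX (n, j)\<in>{0..Nt - 1} \<times> {0..Nx}. \<bar>truncation_error ?K lam0 lam1 f c0 T \<phi> c dt dx dlam Nlam j n\<bar>)
      \<le> \<kappa> * (dt + dx + dlam)"
    proof (rule Max.boundedI)
      fix a assume "a \<in> (\<lambda>(n, j). \<bar>truncation_error ?K lam0 lam1 f c0 T \<phi> c dt dx dlam Nlam j n\<bar>)
        ` ({0..Nt - 1} \<times> {0..Nx})"
      then obtain n j where nj: "n \<le> Nt - 1" "j \<le> Nx"
        and a: "a = \<bar>truncation_error ?K lam0 lam1 f c0 T \<phi> c dt dx dlam Nlam j n\<bar>"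
        by auto
      have "n < Nt"
        using nj H by linarith
      with \<kappa>[of Nx Nt Nlam j n] nj H show "a \<le> \<kappa> * (dt + dx + dlam)"
        unfolding a by simp
    qed auto
  qed
qed

end
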